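(* Let $p\in(0,1)$. Any one-sided e-statistic on $\mathcal M_1$ for $\psi=(\mathrm{ES}_p,\mathrm{VaR}_p)$ that is increasing in its first argument (i.e., the realized loss) is bounded above by $$e'(x,r,z)=1+h(r,z)\left(\frac{(x-z)_+}{(1-p)(r-z)}-1\right)+k(r,z)\,\frac{p-\mathbf 1_{\{x\le z\}}}{1-p},\qquad x\in\mathbb R,\ z<r,$$ for some functions $h,k$ with $0\le h,k\le1$ and $h+k\le1$. The upper bound $e'$ is a one-sided e-statistic for $\psi$. Moreover, $e'$ is a backtest e-statistic for $\psi$ if and only if $h>0$ and $k=0$. The functions $r\mapsto h(r,z)$ and $r\mapsto(r-z)/h(r,z)$ are increasing for all $z<r$ if and only if $e'$ is a monotone backtest e-statistic for $\psi$.
   Context: $\mathcal M_1$ is the set of distributions on $\mathbb R$ with finite mean; $y_+=\max\{y,0\}$; "increasing" and "decreasing" are in the weak sense. For $F\in\mathcal M_1$, $\mathrm{VaR}_p(F)=\inf\{x\in\mathbb R:F(x)\ge p\}$ and $\mathrm{ES}_p(F)=\frac1{1-p}\int_p^1\mathrm{VaR}_\alpha(F)\,\mathrm d\alpha$. Write $\rho=\mathrm{ES}_p$ and $\phi=\mathrm{VaR}_p$. A measurable $[0,\infty]$-valued function $e(x,r,z)$ is a one-sided e-statistic for $\psi=(\rho,\phi)$ if $\int e(x,r,\phi(F))\,\mathrm dF(x)\le1$ for each $F\in\mathcal M_1$ and $r\ge\rho(F)$. A one-sided e-statistic is a backtest e-statistic for $\psi$ if $\int e(x,r,z)\,\mathrm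 dF(x)>1$ for all $(r,z)\in\psi(\mathcal M_1)$ and all $F\in\mathcal M_1$ with $\rho(F)>r$. A backtest e-statistic is monotone if, in addition, $r\mapsto e(x,r,z)$ is decreasing for each $(x,z)$. Since $e'$ is specified only for $z<r$, the bound and these properties of $e'$ are understood for such arguments.
   Formalization: In the last equivalence "h > 0 and k = 0" is added to the monotonicity conditions; without it the claim fails (h = 1/2, k = 1/4 constant). The functions h, k are taken Borel measurable, as e' must be measurable to be an e-statistic. *)

theory Defs
  imports "HOL-Probability.Probability"
begin

definition M1 :: "real measure set" where
  "M1 = {F. real_distribution F \<and> integrable F (\<lambda>x. x)}"

definition VaR :: "real \<Rightarrow> real measure \<Rightarrow> real" where
  "VaR p F = Inf {x. cdf F x \<ge> p}"

definition ES :: "real \<Rightarrow> real measure \<Rightarrow> real" where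
  "ES p F = 1 / (1 - p) * (LBINT \<alpha>:{p<..<1}. VaR \<alpha> F)"

text \<open>
  The notions below carry a set \<open>D\<close> of admissible pairs \<open>(r, z)\<close>: the function \<open>e x r z\<close> is regarded
  as given only for \<open>(r, z) \<in> D\<close>, and every requirement is restricted to such arguments. With
  \<open>D = UNIV\<close> they are the plain notions for a function on all of \<open>\<real>\<^sup>3\<close>.
\<close>

definition one_sided_e_statistic ::
  "(real measure \<Rightarrow> real) \<Rightarrow> (real measure \<Rightarrow> real) \<Rightarrow> (real \<times> real) set
    \<Rightarrow> (real \<Rightarrow> real \<Rightarrow> real \<Rightarrow> ennreal) \<Rightarrow> bool" where
  "one_sided_e_statistic \<rho> \<phi> D e \<longleftrightarrow>
     (\<lambda>(x, r, z). e x r z) \<in> borel_measurable (restrict_space borel (UNIV \<times> D)) \<and>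
     (\<forall>F\<in>M1. \<forall>r\<ge>\<rho> F. (r, \<phi> F) \<in> D \<longrightarrow> (\<integral>\<^sup>+ x. e x r (\<phi> F) \<partial>F) \<le> 1)"

text \<open>The distribution \<open>F\<close> below need not satisfy \<open>\<phi> F = z\<close>.\<close>

definition backtest_e_statistic ::
  "(real measure \<Rightarrow> real) \<Rightarrow> (real measure \<Rightarrow> real) \<Rightarrow> (real \<times> real) set
    \<Rightarrow> (real \<Rightarrow> real \<Rightarrow> real \<Rightarrow> ennreal) \<Rightarrow> bool" where
  "backtest_e_statistic \<rho> \<phi> D e \<longleftrightarrow>
     one_sided_e_statistic \<rho> \<phi> D e \<and>
     (\<forall>(r, z) \<in> (\<lambda>F. (\<rho> F, \<phi> F)) ` M1 \<inter> D. \<forall>F\<in>M1. \<rho> F > r \<longrightarrow> (\<integral>\<^sup>+ x. e x r z \<partial>F) > 1)"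

definition monotone_backtest_e_statistic ::
  "(real measure \<Rightarrow> real) \<Rightarrow> (real measure \<Rightarrow> real) \<Rightarrow> (real \<times> real) set
    \<Rightarrow> (real \<Rightarrow> real \<Rightarrow> real \<Rightarrow> ennreal) \<Rightarrow> bool" where
  "monotone_backtest_e_statistic \<rho> \<phi> D e \<longleftrightarrow>
     backtest_e_statistic \<rho> \<phi> D e \<and>
     (\<forall>x z. antimono_on {r. (r, z) \<in> D} (\<lambda>r. e x r z))"

abbreviation below_diag :: "(real \<times> real) set" where
  "below_diag \<equiv> {(r, z). z < r}"

text \<open>Measurability is part of being an e-statistic, so it is required of the weights.\<close>

definition weights :: "(real \<Rightarrow> real \<Rightarrow> real) \<Rightarrow> (real \<Rightarrow> real \<Rightarrow> real) \<Rightarrow> bool" where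
  "weights h k \<longleftrightarrow>
     (\<lambda>(r, z). h r z) \<in> borel_measurable (restrict_space borel below_diag) \<and>
     (\<lambda>(r, z). k r z) \<in> borel_measurable (restrict_space borel below_diag) \<and>
     (\<forall>r z. z < r \<longrightarrow> 0 \<le> h r z \<and> h r z \<le> 1 \<and> 0 \<le> k r z \<and> k r z \<le> 1 \<and> h r z + k r z \<le> 1)"

definition upper_e ::
  "real \<Rightarrow> (real \<Rightarrow> real \<Rightarrow> real) \<Rightarrow> (real \<Rightarrow> real \<Rightarrow> real) \<Rightarrow> real \<Rightarrow> real \<Rightarrow> real \<Rightarrow> real" where
  "upper_e p h k x r z =
     1 + h r z * (max (x - z) 0 / ((1 - p) * (r - z)) - 1)
       + k r z * ((p - indicat_real {..z} x) / (1 - p))"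

end

theory Submission
  imports Defs
begin

text \<open>
  The quantile transform gives \<open>(1 - p) * (ES p F - c) \<le> E (X - c)\<^sub>+\<close> for every \<open>c\<close>, with equality at
  \<open>c = VaR p F\<close> (Rockafellar--Uryasev); together with \<open>F (VaR p F) \<ge> p\<close> this controls the
  expectation of the upper bound.

  For the domination part, fix \<open>z < r\<close> and put \<open>f x = e x r z\<close>. Testing \<open>e\<close> on laws with mass \<open>p\<close> at \<open>z\<close>
  and the remaining mass on two points of \<open>[z, \<infinity>)\<close> with mean at most \<open>r\<close> says that on \<open>[z, \<infinity>)\<close> the
  concave envelope of \<open>f\<close> at \<open>r\<close> is at most \<open>M = (1 - p * f z) / (1 - p)\<close>, so some increasing line
  through \<open>(r, M)\<close> dominates \<open>f\<close> there. Its slope determines \<open>h\<close>, and \<open>k = 1 - f z - h\<close>.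
\<close>

section \<open>Quantiles and expected shortfall\<close>

lemma VaR_le_iff:
  assumes "real_distribution F" "0 < \<omega>" "\<omega> < 1"
  shows "VaR \<omega> F \<le> x \<longleftrightarrow> \<omega> \<le> cdf F x"
proof -
  interpret cdf_distribution F
    using assms(1) by (simp add: cdf_distribution_def)
  show ?thesis
    using pseudoinverse[of \<omega> x] assms(2,3) by (simp add: VaR_def)
qed

lemma le_cdf_VaR:
  assumes "real_distribution F" "0 < \<omega>" "\<omega> < 1"
  shows "\<omega> \<le> cdf F (VaR \<omega> F)"
  using VaR_le_iff[OF assms, of "VaR \<omega> F"] by simp

lemma VaR_mono:
  assumes "real_distribution F" "0 < \<alpha>" "\<alpha> \<le> \<beta>" "\<beta> < 1"
  shows "VaR \<alpha> F \<le> VaR \<beta> F"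
  using VaR_le_iff[OF assms(1), of \<alpha> "VaR \<beta> F"] le_cdf_VaR[OF assms(1), of \<beta>] assms by simp

text \<open>Under Lebesgue measure on (0,1) the quantile function has law \<open>F\<close>, so both
  claims are a change of variables.\<close>

lemma quantile_transform:
  fixes g :: "real \<Rightarrow> real"
  assumes F: "real_distribution F" and [measurable]: "g \<in> borel_measurable borel"
    and g: "integrable F g"
  shows "set_integrable lborel {0<..<1} (\<lambda>\<alpha>. g (VaR \<alpha> F))"
    and "(LBINT \<alpha>:{0<..<1}. g (VaR \<alpha> F)) = (\<integral>x. g x \<partial>F)"
proof -
  interpret cdf_distribution F
    using F by (simp add: cdf_distribution_def)
  have V: "(\<lambda>\<alpha>. VaR \<alpha> F) \<in> restrict_space lborel {0<..<1} \<rightarrow>\<^sub>M borel"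
    using measurable_CI by (simp add: VaR_def cong: measurable_cong_sets sets_restrict_space_cong)
  have D: "distr (restrict_space lborel {0<..<1}) borel (\<lambda>\<alpha>. VaR \<alpha> F) = F"
    using distr_I_eq_M by (simp add: VaR_def)
  have "integrable (restrict_space lborel {0<..<1}) (\<lambda>\<alpha>. g (VaR \<alpha> F))"
    using g integrable_distr_eq[OF V, of g] by (simp add: D)
  then show "set_integrable lborel {0<..<1} (\<lambda>\<alpha>. g (VaR \<alpha> F))"
    by (simp add: set_integrable_def integrable_restrict_space)
  have "(\<integral>x. g x \<partial>F) = (\<integral>\<alpha>. g (VaR \<alpha> F) \<partial>restrict_space lborel {0<..<1})"
    using integral_distr[OF V, of g] by (simp add: D)
  then show "(LBINT \<alpha>:{0<..<1}. g (VaR \<alpha> F)) = (\<integral>x. g x \<partial>F)"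
    by (simp add: set_lebesgue_integral_def integral_restrict_space)
qed

lemma M1_integrable_excess:
  assumes "F \<in> M1"
  shows "integrable F (\<lambda>x. max (x - c) 0)"
proof -
  interpret real_distribution F
    using assms by (simp add: M1_def)
  have "integrable F (\<lambda>x. x - c)"
    using assms by (simp add: M1_def)
  then show ?thesis
    by auto
qed

lemma expected_excess_eq:
  assumes "F \<in> M1"
  shows "(\<integral>x. max (x - c) 0 \<partial>F) = (LBINT \<alpha>:{0<..<1}. max (VaR \<alpha> F - c) 0)"
  using assms M1_integrable_excess[OF assms]
  by (intro quantile_transform(2)[symmetric]) (simp_all add: M1_def)

lemma ES_minus_eq:
  assumes "F \<in> M1" "0 < p" "p < 1"
  shows "set_integrable lborel {p<..<1} (\<lambda>\<alpha>. VaR \<alpha> F - c)"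
    and "(1 - p) * (ES p F - c) = (LBINT \<alpha>:{p<..<1}. VaR \<alpha> F - c)"
proof -
  have "set_integrable lborel {0<..<1} (\<lambda>\<alpha>. VaR \<alpha> F)"
    using assms by (intro quantile_transform(1)) (simp_all add: M1_def)
  then have V: "set_integrable lborel {p<..<1} (\<lambda>\<alpha>. VaR \<alpha> F)"
    by (rule set_integrable_subset) (use assms in auto)
  have C: "set_integrable lborel {p<..<1} (\<lambda>\<alpha>. c)"
    using assms by (simp add: set_integrable_def integrable_real_indicator)
  show "set_integrable lborel {p<..<1} (\<lambda>\<alpha>. VaR \<alpha> F - c)"
    using V C by (rule set_integral_diff)
  have "(LBINT \<alpha>:{p<..<1}. VaR \<alpha> F - c) = (LBINT \<alpha>:{p<..<1}. VaR \<alpha> F) - (1 - p) * c"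
    using assms by (subst set_integral_diff(2)[OF V C]) (simp add: set_lebesgue_integral_def)
  moreover have "(1 - p) * ES p F = (LBINT \<alpha>:{p<..<1}. VaR \<alpha> F)"
    using assms by (simp add: ES_def)
  ultimately show "(1 - p) * (ES p F - c) = (LBINT \<alpha>:{p<..<1}. VaR \<alpha> F - c)"
    by (simp add: right_diff_distrib)
qed

text \<open>The integrand \<open>VaR \<alpha> F - c\<close> is at most its positive part, and
  extending the domain to \<open>{0<..<1}\<close> adds only a nonnegative amount. The freedom in
  \<open>c\<close> matters for laws whose quantile is not \<open>z\<close>.\<close>

lemma ES_le:
  assumes "F \<in> M1" "0 < p" "p < 1"
  shows "(1 - p) * (ES p F - c) \<le> (\<integral>x. max (x - c) 0 \<partial>F)"
proof -
  have "set_integrable lborel {0<..<1} (\<lambda>\<alpha>. max (VaR \<alpha> F - c) 0)"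
    using assms M1_integrable_excess[OF assms(1)]
    by (intro quantile_transform(1)) (auto simp: M1_def)
  then have "(LBINT \<alpha>:{p<..<1}. VaR \<alpha> F - c) \<le> (LBINT \<alpha>:{0<..<1}. max (VaR \<alpha> F - c) 0)"
    using ES_minus_eq(1)[OF assms] assms(2) unfolding set_lebesgue_integral_def set_integrable_def
    by (intro integral_mono) (auto simp: indicator_def)
  then show ?thesis
    using ES_minus_eq(2)[OF assms] expected_excess_eq[OF assms(1)] by simp
qed

text \<open>At the quantile itself nothing is lost: \<open>VaR\<close> increases in its level, so
  the positive part of the difference vanishes up to level \<open>p\<close> and equals the
  difference beyond it.\<close>

lemma ES_eq:
  assumes "F \<in> M1" "0 < p" "p < 1"
  shows "(1 - p) * (ES p F - VaR p F) = (\<integral>x. max (x - VaR p F) 0 \<partial>F)"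
proof -
  have F: "real_distribution F"
    using assms by (simp add: M1_def)
  have "(LBINT \<alpha>:{p<..<1}. VaR \<alpha> F - VaR p F) = (LBINT \<alpha>:{0<..<1}. max (VaR \<alpha> F - VaR p F) 0)"
    unfolding set_lebesgue_integral_def
  proof (rule Bochner_Integration.integral_cong)
    fix \<alpha> :: real
    show "indicat_real {p<..<1} \<alpha> *\<^sub>R (VaR \<alpha> F - VaR p F)
        = indicat_real {0<..<1} \<alpha> *\<^sub>R max (VaR \<alpha> F - VaR p F) 0"
      using VaR_mono[OF F, of \<alpha> p] VaR_mono[OF F, of p \<alpha>] assms(2,3)
      by (cases "\<alpha> \<le> p") (auto simp: indicator_def)
  qed simp
  then show ?thesis
    using ES_minus_eq(2)[OF assms] expected_excess_eq[OF assms(1)] by simp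
qed

section \<open>Test distributions with at most three atoms\<close>

text \<open>The mixture of atoms at \<open>z\<close>, \<open>u\<close>, \<open>v\<close> with
  weights \<open>a\<close>, \<open>(1 - a) * s\<close>, \<open>(1 - a) * (1 - s)\<close>. As the
  image of two independent coin tosses it turns every integral into a finite sum.\<close>

definition three_point :: "real \<Rightarrow> real \<Rightarrow> real \<Rightarrow> real \<Rightarrow> real \<Rightarrow> real measure" where
  "three_point a s z u v = distr (measure_pmf (pair_pmf (bernoulli_pmf a) (bernoulli_pmf s))) borel
     (\<lambda>(b, c). if b then z else if c then u else v)"

lemma UNIV_bool_pair: "(UNIV :: (bool \<times> bool) set) =
    {(True, True), (True, False), (False, True), (False, False)}"
  by (auto simp: UNIV_bool)

context
  fixes a s z u v :: real
  assumes weights01: "0 \<le> a" "a \<le> 1" "0 \<le> s" "s \<le> 1"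
begin

lemma integral_three_point:
  fixes g :: "real \<Rightarrow> real"
  assumes "g \<in> borel_measurable borel"
  shows "(\<integral>x. g x \<partial>three_point a s z u v) = a * g z + (1 - a) * (s * g u + (1 - s) * g v)"
proof -
  have "(\<integral>x. g x \<partial>three_point a s z u v) =
      (\<integral>y. g (case y of (b, c) \<Rightarrow> if b then z else if c then u else v)
        \<partial>measure_pmf (pair_pmf (bernoulli_pmf a) (bernoulli_pmf s)))"
    unfolding three_point_def by (subst integral_distr) (use assms in auto)
  also have "\<dots> = a * g z + (1 - a) * (s * g u + (1 - s) * g v)"
    using weights01 by (subst integral_measure_pmf_real[of UNIV, OF finite UNIV_I])
      (simp add: UNIV_bool_pair pmf_pair algebra_simps)
  finally show ?thesis .
qed

lemma nn_integral_three_point: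
  assumes "g \<in> borel_measurable borel"
  shows "(\<integral>\<^sup>+x. g x \<partial>three_point a s z u v) =
    g z * ennreal a + g u * ennreal ((1 - a) * s) + g v * ennreal ((1 - a) * (1 - s))"
proof -
  have "(\<integral>\<^sup>+x. g x \<partial>three_point a s z u v) =
      (\<integral>\<^sup>+y. g (case y of (b, c) \<Rightarrow> if b then z else if c then u else v)
        \<partial>measure_pmf (pair_pmf (bernoulli_pmf a) (bernoulli_pmf s)))"
    unfolding three_point_def by (subst nn_integral_distr) (use assms in auto)
  also have "\<dots> = g z * (ennreal (a * s) + ennreal (a * (1 - s)))
      + (g u * ennreal ((1 - a) * s) + g v * ennreal ((1 - a) * (1 - s)))"
    using weights01 by (subst nn_integral_measure_pmf_support[of UNIV, OF finite])
      (simp, simp, simp add: UNIV_bool_pair pmf_pair algebra_simps)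
  \<comment> \<open>Both outcomes of the second toss lead to \<open>z\<close> once the first
    succeeds.\<close>
  also have "ennreal (a * s) + ennreal (a * (1 - s)) = ennreal a"
    using weights01 by (subst ennreal_plus[symmetric]) (simp_all add: right_diff_distrib mult_left_le)
  finally show ?thesis
    by (simp add: add.assoc)
qed

lemma three_point_M1: "three_point a s z u v \<in> M1"
proof -
  have "real_distribution (three_point a s z u v)"
    unfolding three_point_def
    by (intro prob_space.real_distribution_distr) (auto intro: prob_space_measure_pmf)
  moreover have "integrable (three_point a s z u v) (\<lambda>x. x)"
    unfolding three_point_def by (subst integrable_distr_eq) (auto intro: integrable_measure_pmf_finite)
  ultimately show ?thesis
    by (simp add: M1_def)
qed

lemma cdf_three_point:
  "cdf (three_point a s z u v) x =
    a * indicat_real {..x} z + (1 - a) * (s * indicat_real {..x} u + (1 - s) * indicat_real {..x} v)"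
proof -
  have "cdf (three_point a s z u v) x = (\<integral>y. indicat_real {..x} y \<partial>three_point a s z u v)"
    by (simp add: cdf_def three_point_def)
  then show ?thesis
    by (subst (asm) integral_three_point) simp_all
qed

text \<open>The leftmost atom \<open>z\<close> carries mass at least \<open>p\<close>, and the cdf
  vanishes to its left.\<close>

lemma VaR_three_point:
  assumes p: "0 < p" "p < 1" "p \<le> a" and le: "z \<le> u" "z \<le> v"
  shows "VaR p (three_point a s z u v) = z"
proof (rule antisym)
  have F: "real_distribution (three_point a s z u v)"
    using three_point_M1 by (simp add: M1_def)
  have "a \<le> cdf (three_point a s z u v) z"
    using weights01 by (simp add: cdf_three_point)
  then show "VaR p (three_point a s z u v) \<le> z"
    using p by (subst VaR_le_iff[OF F]) auto
  have "\<not> VaR p (three_point a s z u v) < z"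
  proof
    assume "VaR p (three_point a s z u v) < z"
    then have "cdf (three_point a s z u v) (VaR p (three_point a s z u v)) = 0"
      using le by (subst cdf_three_point) (auto simp: indicator_def)
    then show False
      using le_cdf_VaR[OF F p(1,2)] p(1) by simp
  qed
  then show "z \<le> VaR p (three_point a s z u v)"
    by simp
qed

lemma ES_three_point:
  assumes p: "0 < p" "p < 1" "p \<le> a" and le: "z \<le> u" "z \<le> v"
  shows "ES p (three_point a s z u v) = z + (1 - a) * (s * (u - z) + (1 - s) * (v - z)) / (1 - p)"
proof -
  have "(1 - p) * (ES p (three_point a s z u v) - z) = (1 - a) * (s * (u - z) + (1 - s) * (v - z))"
    using ES_eq[OF three_point_M1 p(1,2)] le
    by (simp add: VaR_three_point[OF assms] integral_three_point)
  then show ?thesis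
    using p by (simp add: field_simps)
qed

end

section \<open>Sign and expectation of the upper bound\<close>

text \<open>The factors of \<open>h\<close> and \<open>k\<close> are both at least -1, so the value
  is at least \<open>1 - h r z - k r z\<close>. Hence \<open>ennreal\<close> truncates
  nothing.\<close>

lemma upper_e_nonneg:
  assumes p: "0 < p" "p < 1" and hk: "0 \<le> h r z" "0 \<le> k r z" "h r z + k r z \<le> 1" and "z < r"
  shows "0 \<le> upper_e p h k x r z"
proof -
  have "0 \<le> h r z * (max (x - z) 0 / ((1 - p) * (r - z)))"
    using p hk(1) \<open>z < r\<close> by (intro mult_nonneg_nonneg divide_nonneg_nonneg) simp_all
  moreover have "- k r z \<le> k r z * ((p - indicat_real {..z} x) / (1 - p))"
  proof -
    have "- 1 \<le> (p - indicat_real {..z} x) / (1 - p)"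
      using p by (simp add: indicator_def le_divide_eq)
    from mult_left_mono[OF this hk(2)] show ?thesis
      by simp
  qed
  ultimately show ?thesis
    using hk by (simp add: upper_e_def algebra_simps)
qed

text \<open>Nonnegativity permits the passage to the Bochner integral, and linearity leaves only two
  features of \<open>F\<close>: the expected excess over \<open>z\<close> and
  \<open>cdf F z\<close>.\<close>

lemma nn_integral_upper_e:
  assumes p: "0 < p" "p < 1" and hk: "0 \<le> h r z" "0 \<le> k r z" "h r z + k r z \<le> 1" and "z < r"
    and F: "F \<in> M1"
  shows "(\<integral>\<^sup>+x. ennreal (upper_e p h k x r z) \<partial>F) =
    ennreal (1 + h r z * ((\<integral>x. max (x - z) 0 \<partial>F) / ((1 - p) * (r - z)) - 1)
      + k r z * ((p - cdf F z) / (1 - p)))"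
proof -
  interpret real_distribution F
    using F by (simp add: M1_def)
  note I = M1_integrable_excess[OF F, of z]
  have J: "integrable F (indicat_real {..z})"
    by (simp add: integrable_real_indicator emeasure_eq_measure)
  have "(\<integral>\<^sup>+x. ennreal (upper_e p h k x r z) \<partial>F) = ennreal (\<integral>x. upper_e p h k x r z \<partial>F)"
  proof (rule nn_integral_eq_integral)
    show "integrable F (\<lambda>x. upper_e p h k x r z)"
      unfolding upper_e_def using I J by auto
  qed (use upper_e_nonneg[where h = h and k = k, OF p hk \<open>z < r\<close>] in auto)
  also have "(\<integral>x. upper_e p h k x r z \<partial>F) =
      1 + h r z * ((\<integral>x. max (x - z) 0 \<partial>F) / ((1 - p) * (r - z)) - 1)
        + k r z * ((p - cdf F z) / (1 - p))"
    unfolding upper_e_def using I J by (simp add: cdf_def prob_space[unfolded space_eq_univ])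
  finally show ?thesis .
qed

section \<open>An affine majorant for fixed \<open>r\<close> and \<open>z\<close>\<close>

text \<open>
  With \<open>M = (1 - p * f z) / (1 - p)\<close>, this is \<open>(1 - p) * (r - z)\<close> times the largest slope of a line
  through \<open>(r, M)\<close> that stays above \<open>f\<close> on \<open>[z, r)\<close>. Restricting the infimum to rational \<open>q\<close>
  changes nothing for monotone \<open>f\<close> and makes the weight measurable in \<open>(r, z)\<close>.
\<close>

definition slope_weight :: "real \<Rightarrow> (real \<Rightarrow> real) \<Rightarrow> real \<Rightarrow> real \<Rightarrow> real" where
  "slope_weight p f r z =
    (INF q\<in>\<rat> \<inter> {0..<1}. (1 - p * f z - (1 - p) * f (z + q * (r - z))) / (1 - q))"

text \<open>\<open>test\<close> is the real-valued form of the one-sided bound under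
  \<open>three_point p s z u v\<close>.\<close>

context
  fixes p :: real and f :: "real \<Rightarrow> real" and r z :: real
  assumes p: "0 < p" "p < 1" and f: "mono f" and rz: "z < r"
    and test: "\<And>s u v. 0 \<le> s \<Longrightarrow> s \<le> 1 \<Longrightarrow> z \<le> u \<Longrightarrow> z \<le> v \<Longrightarrow> s * u + (1 - s) * v \<le> r \<Longrightarrow>
      p * f z + (1 - p) * (s * f u + (1 - s) * f v) \<le> 1"
begin

lemma scaled_le_of_le:
  assumes "z \<le> u" "u \<le> r"
  shows "(1 - p) * f u \<le> 1 - p * f z"
  using test[of 1 u u] assms by simp

lemma slope_quotient_nonneg:
  assumes "0 \<le> q" "q < 1"
  shows "0 \<le> (1 - p * f z - (1 - p) * f (z + q * (r - z))) / (1 - q)"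
proof -
  have "0 \<le> q * (r - z)" "q * (r - z) \<le> r - z"
    using assms rz by (simp_all add: mult_left_le_one_le)
  then have "(1 - p) * f (z + q * (r - z)) \<le> 1 - p * f z"
    by (intro scaled_le_of_le) simp_all
  then show ?thesis
    using assms by (intro divide_nonneg_pos) simp_all
qed

lemma slope_weight_nonneg: "0 \<le> slope_weight p f r z"
proof -
  have "0 \<in> \<rat> \<inter> {0..<1::real}"
    by simp
  then show ?thesis
    unfolding slope_weight_def by (intro cINF_greatest) (auto intro: slope_quotient_nonneg)
qed

lemma slope_weight_le:
  assumes "q \<in> \<rat>" "0 \<le> q" "q < 1"
  shows "slope_weight p f r z * (1 - q) \<le> 1 - p * f z - (1 - p) * f (z + q * (r - z))"
proof -
  have "bdd_below ((\<lambda>q. (1 - p * f z - (1 - p) * f (z + q * (r - z))) / (1 - q)) ` (\<rat> \<inter> {0..<1}))"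
    using slope_quotient_nonneg by (intro bdd_belowI2) auto
  then have "slope_weight p f r z \<le> (1 - p * f z - (1 - p) * f (z + q * (r - z))) / (1 - q)"
    unfolding slope_weight_def using assms by (intro cINF_lower) auto
  then show ?thesis
    using assms by (simp add: le_divide_eq)
qed

text \<open>The quotient at \<open>q = 0\<close> is exactly \<open>1 - f z\<close>. This is what
  makes the later choice \<open>k = 1 - f z - h\<close> nonnegative.\<close>

lemma slope_weight_le_complement: "slope_weight p f r z \<le> 1 - f z"
  using slope_weight_le[of 0] by (simp add: algebra_simps)

text \<open>A strict violation at a real \<open>t\<close> would persist at a rational
  \<open>q\<close> slightly to the right, where \<open>f\<close> is at least as large, contradicting
  the bound at \<open>q\<close>.\<close>

lemma slope_weight_le_real:
  assumes t: "0 \<le> t" "t < 1"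
  shows "slope_weight p f r z * (1 - t) \<le> 1 - p * f z - (1 - p) * f (z + t * (r - z))"
proof (rule ccontr)
  let ?h = "slope_weight p f r z" and ?B = "1 - p * f z - (1 - p) * f (z + t * (r - z))"
  assume "\<not> ?thesis"
  then have less: "?B < ?h * (1 - t)"
    by simp
  have B: "0 \<le> ?B"
    using slope_quotient_nonneg[OF t] t by (simp add: zero_le_divide_iff)
  with less t have h: "0 < ?h"
    by (smt (verit) mult_nonpos_nonneg)
  \<comment> \<open>At \<open>1 - ?B / ?h\<close> the line \<open>?h * (1 - q)\<close> has dropped
    to \<open>?B\<close>, so any smaller \<open>q\<close> keeps the strict violation.\<close>
  then have "t < 1 - ?B / ?h"
    using less by (simp add: field_simps)
  then obtain q where q: "q \<in> \<rat>" "t < q" "q < 1 - ?B / ?h"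
    using Rats_dense_in_real by blast
  then have q1: "0 \<le> q" "q < 1"
    using t B h by (auto intro: less_le_trans)
  have "?B < ?h * (1 - q)"
    using q(3) h by (simp add: field_simps)
  also have "\<dots> \<le> 1 - p * f z - (1 - p) * f (z + q * (r - z))"
    by (rule slope_weight_le[OF q(1) q1])
  also have "\<dots> \<le> ?B"
    using p q(2) rz monoD[OF f, of "z + t * (r - z)" "z + q * (r - z)"] by simp
  finally show False
    by simp
qed

text \<open>Every quotient to the left of \<open>r\<close> dominates every such slope to the right,
  since mixing one point from each side with mean \<open>r\<close> is a case of \<open>test\<close>.
  Hence the infimum dominates too.\<close>

lemma slope_weight_ge:
  assumes t: "1 < t"
  shows "(1 - p) * f (z + t * (r - z)) - (1 - p * f z) \<le> slope_weight p f r z * (t - 1)"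
proof -
  let ?v = "z + t * (r - z)"
  have "((1 - p) * f ?v - (1 - p * f z)) / (t - 1) \<le> slope_weight p f r z"
    unfolding slope_weight_def
  proof (rule cINF_greatest)
    have "0 \<in> \<rat> \<inter> {0..<1::real}"
      by simp
    then show "\<rat> \<inter> {0..<1::real} \<noteq> {}"
      by blast
  next
    fix q :: real
    assume "q \<in> \<rat> \<inter> {0..<1}"
    then have q: "0 \<le> q" "q < 1"
      by auto
    \<comment> \<open>The weight \<open>?s\<close> balances the two points so that their mean is
      exactly \<open>r\<close>.\<close>
    let ?u = "z + q * (r - z)" and ?s = "(t - 1) / (t - q)"
    have s: "1 - ?s = (1 - q) / (t - q)"
      using q t by (simp add: field_simps)
    have st: "?s * q + (1 - ?s) * t = 1"
      unfolding s using q t by (simp add: divide_simps) (simp add: algebra_simps)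
    have "a * ?u + (1 - a) * ?v = z + (a * q + (1 - a) * t) * (r - z)" for a
      by (simp add: algebra_simps)
    from this[of ?s] have "?s * ?u + (1 - ?s) * ?v = z + (?s * q + (1 - ?s) * t) * (r - z)" .
    then have mean: "?s * ?u + (1 - ?s) * ?v \<le> r"
      unfolding st by simp
    have "p * f z + (1 - p) * (?s * f ?u + (1 - ?s) * f ?v) \<le> 1"
    proof (rule test[OF _ _ _ _ mean])
      show "0 \<le> ?s" "?s \<le> 1"
        using q t by simp_all
      show "z \<le> ?u" "z \<le> ?v"
        using q t rz by simp_all
    qed
    then have "(p * f z + (1 - p) * (?s * f ?u + (1 - ?s) * f ?v)) * (t - q) \<le> t - q"
      using q t by (simp add: mult_left_le_one_le)
    moreover have "?s * (t - q) = t - 1" "(1 - ?s) * (t - q) = 1 - q"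
      unfolding s using q t by simp_all
    then have "(p * f z + (1 - p) * (?s * f ?u + (1 - ?s) * f ?v)) * (t - q)
        = p * f z * (t - q) + (1 - p) * ((t - 1) * f ?u + (1 - q) * f ?v)"
      by algebra
    ultimately have "((1 - p) * f ?v - (1 - p * f z)) * (1 - q)
        \<le> (1 - p * f z - (1 - p) * f ?u) * (t - 1)"
      by (simp add: algebra_simps)
    then show "((1 - p) * f ?v - (1 - p * f z)) / (t - 1) \<le> (1 - p * f z - (1 - p) * f ?u) / (1 - q)"
      using q t by (simp add: divide_simps mult.commute)
  qed
  then show ?thesis
    using t by (simp add: divide_le_eq)
qed

text \<open>In the scale sending \<open>z\<close> to 0 and \<open>r\<close> to 1, the bounds on the
  two sides meet at 1, where the slope term drops out.\<close>

lemma le_affine_bound: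
  assumes "z < x"
  shows "(1 - p) * f x \<le> 1 - p * f z + slope_weight p f r z * ((x - z) / (r - z) - 1)"
proof -
  define t where "t = (x - z) / (r - z)"
  have x: "x = z + t * (r - z)"
    using rz by (simp add: t_def)
  have t: "0 \<le> t"
    using assms rz by (simp add: t_def)
  consider "t < 1" | "t = 1" | "1 < t"
    by linarith
  then have "(1 - p) * f (z + t * (r - z)) \<le> 1 - p * f z + slope_weight p f r z * (t - 1)"
  proof cases
    case 1
    then show ?thesis
      using slope_weight_le_real[OF t] by (simp add: algebra_simps)
  next
    case 2
    then show ?thesis
      using scaled_le_of_le[of r] rz by simp
  next
    case 3
    then show ?thesis
      using slope_weight_ge[of t] by simp
  qed
  then show ?thesis
    by (simp add: x[symmetric]) (simp add: t_def)
qed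

text \<open>The choice of \<open>k\<close> makes the bound equal \<open>f z\<close> for
  \<open>x \<le> z\<close>, where monotonicity suffices. For larger \<open>x\<close>,
  \<open>1 - p\<close> times the bound is exactly the majorant of
  \<open>le_affine_bound\<close>.\<close>

lemma le_upper_e:
  assumes h: "h r z = slope_weight p f r z" and k: "k r z = 1 - f z - h r z"
  shows "f x \<le> upper_e p h k x r z"
proof (cases "x \<le> z")
  case True
  then have "(p - indicat_real {..z} x) / (1 - p) = -1" "max (x - z) 0 = 0"
    using p by (auto simp: field_simps)
  then show ?thesis
    using monoD[OF f True] by (simp add: upper_e_def k)
next
  case False
  let ?t = "(x - z) / (r - z)"
  have "(1 - p) * upper_e p h k x r z = 1 - p * f z + h r z * (?t - 1)"
  proof -
    have "(1 - p) * (max (x - z) 0 / ((1 - p) * (r - z))) = ?t"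
      "(1 - p) * ((p - indicat_real {..z} x) / (1 - p)) = p"
      using False p by simp_all
    moreover have "(1 - p) * (1 + h r z * (a - 1) + k r z * b)
        = 1 - p + h r z * ((1 - p) * a - (1 - p)) + k r z * ((1 - p) * b)" for a b
      by (simp add: algebra_simps)
    then have "(1 - p) * upper_e p h k x r z = 1 - p
        + h r z * ((1 - p) * (max (x - z) 0 / ((1 - p) * (r - z))) - (1 - p))
        + k r z * ((1 - p) * ((p - indicat_real {..z} x) / (1 - p)))"
      unfolding upper_e_def .
    ultimately show ?thesis
      unfolding k by (simp add: algebra_simps)
  qed
  then have "(1 - p) * f x \<le> (1 - p) * upper_e p h k x r z"
    using le_affine_bound[of x] False h by simp
  then show ?thesis
    using p by simp
qed

end

section \<open>Domination of increasing one-sided e-statistics\<close>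

lemma one_sided_measurable:
  assumes "one_sided_e_statistic \<rho> \<phi> UNIV e"
  shows "(\<lambda>(x, r, z). e x r z) \<in> borel_measurable borel"
  using assms measurable_cong_sets[OF sets_restrict_UNIV refl]
  unfolding one_sided_e_statistic_def by (metis UNIV_Times_UNIV)

text \<open>With mass exactly \<open>p\<close> at the lowest atom, the shortfall is the mean of the
  other two, so \<open>mean\<close> bounds it by \<open>r\<close>. Values stay in
  \<open>ennreal\<close> because \<open>e\<close> is not yet known to be finite.\<close>

lemma one_sided_three_point:
  assumes p: "0 < p" "p < 1" and e: "one_sided_e_statistic (ES p) (VaR p) UNIV e"
    and s: "0 \<le> s" "s \<le> 1" and uv: "z \<le> u" "z \<le> v" and mean: "s * u + (1 - s) * v \<le> r"
  shows "e z r z * ennreal p + e u r z * ennreal ((1 - p) * s) + e v r z * ennreal ((1 - p) * (1 - s)) \<le> 1"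
proof -
  let ?F = "three_point p s z u v"
  have w: "0 \<le> p" "p \<le> 1" "0 \<le> s" "s \<le> 1"
    using p s by auto
  have V: "VaR p ?F = z"
    by (rule VaR_three_point[OF w p order_refl uv])
  have "ES p ?F = z + (s * (u - z) + (1 - s) * (v - z))"
    using p by (simp add: ES_three_point[OF w p order_refl uv])
  also have "\<dots> \<le> r"
    using mean by (simp add: algebra_simps)
  finally have "(\<integral>\<^sup>+x. e x r z \<partial>?F) \<le> 1"
    using e three_point_M1[OF w, of z u v] unfolding one_sided_e_statistic_def by (metis V UNIV_I)
  moreover have "(\<lambda>x. e x r z) \<in> borel_measurable borel"
  proof -
    have "(\<lambda>x :: real. (x, r, z)) \<in> borel_measurable borel"
      by (intro borel_measurable_Pair) simp_all
    from measurable_compose[OF this one_sided_measurable[OF e]] show ?thesis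
      by simp
  qed
  ultimately show ?thesis
    by (simp add: nn_integral_three_point[OF w])
qed

text \<open>A point \<open>v\<close> beyond \<open>x\<close> and \<open>r\<close> has positive mass
  under a law with shortfall \<open>r\<close>, so \<open>e\<close> is finite at \<open>v\<close>
  and, by monotonicity, at \<open>x\<close>.\<close>

lemma one_sided_finite:
  assumes p: "0 < p" "p < 1" and e: "one_sided_e_statistic (ES p) (VaR p) UNIV e"
    and mono: "mono (\<lambda>x. e x r z)" and "z < r"
  shows "e x r z < \<infinity>"
proof -
  define v where "v = max x r + 1"
  \<comment> \<open>This weight gives the atoms \<open>z\<close> and \<open>v\<close> mean exactly
    \<open>r\<close>.\<close>
  define s where "s = (v - r) / (v - z)"
  have v: "r < v" "z < v" "x \<le> v"
    using \<open>z < r\<close> by (auto simp: v_def)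
  have s: "0 \<le> s" "s \<le> 1" "0 < 1 - s"
    using v \<open>z < r\<close> by (auto simp: s_def)
  have "s * z + (1 - s) * v = v - s * (v - z)"
    by (simp add: algebra_simps)
  then have "s * z + (1 - s) * v = r"
    using v by (simp add: s_def)
  then have "e z r z * ennreal p + e z r z * ennreal ((1 - p) * s) + e v r z * ennreal ((1 - p) * (1 - s)) \<le> 1"
    using v s by (intro one_sided_three_point[OF p e]) auto
  then have "e v r z * ennreal ((1 - p) * (1 - s)) \<le> 1"
    by (rule order_trans[rotated]) (simp add: add_increasing)
  moreover have "0 < ennreal ((1 - p) * (1 - s))"
    using p s by simp
  ultimately have "e v r z < \<infinity>"
    by (auto simp: less_top[symmetric] ennreal_top_mult top_unique split: if_splits)
  with monoD[OF mono v(3)] show ?thesis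
    by (rule order_le_less_trans)
qed

lemma one_sided_upper_bound:
  fixes e :: "real \<Rightarrow> real \<Rightarrow> real \<Rightarrow> ennreal"
  assumes p: "0 < p" "p < 1" and e: "one_sided_e_statistic (ES p) (VaR p) UNIV e"
    and mono: "\<And>r z. mono (\<lambda>x. e x r z)"
  obtains h k where "weights h k" "\<And>x r z. z < r \<Longrightarrow> e x r z \<le> ennreal (upper_e p h k x r z)"
proof -
  \<comment> \<open>\<open>enn2real\<close> sends infinity to 0, so \<open>f\<close> is used in
    place of \<open>e\<close> only for \<open>z < r\<close>, where finiteness is known.\<close>
  define f where "f r z x = enn2real (e x r z)" for r z x
  define h where "h r z = slope_weight p (f r z) r z" for r z
  define k where "k r z = 1 - f r z z - h r z" for r z
  have e_eq: "e x r z = ennreal (f r z x)" if "z < r" for x r z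
    using one_sided_finite[OF p e mono that] by (simp add: f_def)
  have f_nonneg: "0 \<le> f r z x" for r z x
    by (simp add: f_def)
  have f_mono: "mono (f r z)" if "z < r" for r z
    using monoD[OF mono, of _ _ r z] by (auto intro!: monoI simp: e_eq[OF that] f_nonneg)
  have test: "p * f r z z + (1 - p) * (s * f r z u + (1 - s) * f r z v) \<le> 1"
    if "z < r" "0 \<le> s" "s \<le> 1" "z \<le> u" "z \<le> v" "s * u + (1 - s) * v \<le> r" for r z s u v
  proof -
    have "ennreal (f r z z * p + f r z u * ((1 - p) * s) + f r z v * ((1 - p) * (1 - s))) \<le> ennreal 1"
      using one_sided_three_point[OF p e that(2-)] p that(2,3) f_nonneg
      by (simp add: e_eq[OF that(1)] ennreal_mult[symmetric] ennreal_plus[symmetric] del: ennreal_plus)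
    then show ?thesis
      by (simp add: algebra_simps)
  qed
  have h0: "0 \<le> h r z" if "z < r" for r z
    unfolding h_def by (rule slope_weight_nonneg[OF p f_mono[OF that] that test[OF that]])
  have h1: "h r z \<le> 1 - f r z z" if "z < r" for r z
    unfolding h_def by (rule slope_weight_le_complement[OF p f_mono[OF that] that test[OF that]])
  have bound: "e x r z \<le> ennreal (upper_e p h k x r z)" if "z < r" for x r z
    unfolding e_eq[OF that]
    by (intro ennreal_leI le_upper_e[OF p f_mono[OF that] that test[OF that]]) (simp_all add: h_def k_def)
  have [measurable]: "(\<lambda>y. f (a y) (b y) (c y)) \<in> borel_measurable borel"
    if "a \<in> borel_measurable borel" "b \<in> borel_measurable borel" "c \<in> borel_measurable borel"
    for a b c :: "real \<times> real \<Rightarrow> real"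
  proof -
    have "(\<lambda>y. (c y, a y, b y)) \<in> borel_measurable borel"
      using that by (intro borel_measurable_Pair)
    from measurable_compose[OF this one_sided_measurable[OF e]] show ?thesis
      unfolding f_def by simp
  qed
  have Q: "countable (\<rat> \<inter> {0..<1::real})"
    using countable_rat by blast
  have [measurable]: "fst \<in> borel_measurable (borel :: (real \<times> real) measure)"
    "snd \<in> borel_measurable (borel :: (real \<times> real) measure)"
    by (simp_all add: borel_prod[symmetric])
  \<comment> \<open>The infimum runs over countably many measurable functions of
    \<open>(r, z)\<close>; measurability is obtained on the whole plane and restricted
    later.\<close>
  have hm [measurable]: "(\<lambda>(r, z). h r z) \<in> borel_measurable borel"
    unfolding h_def slope_weight_def split_beta' using Q
    by (intro borel_measurable_cINF_real) measurable
  have km: "(\<lambda>(r, z). k r z) \<in> borel_measurable borel"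
    using hm unfolding k_def split_beta' by measurable
  have "weights h k"
    unfolding weights_def
  proof (intro conjI allI impI)
    show "(\<lambda>(r, z). h r z) \<in> borel_measurable (restrict_space borel below_diag)"
      "(\<lambda>(r, z). k r z) \<in> borel_measurable (restrict_space borel below_diag)"
      using hm km by (auto intro: measurable_restrict_space1)
  next
    fix r z :: real
    assume "z < r"
    then show "0 \<le> h r z" "h r z \<le> 1" "0 \<le> k r z" "k r z \<le> 1" "h r z + k r z \<le> 1"
      using h0[of z r] h1[of z r] f_nonneg[of r z z] by (auto simp: k_def)
  qed
  then show ?thesis
    using bound that by blast
qed

section \<open>The upper bound as an e-statistic and as a backtest\<close>

text \<open>At \<open>z = VaR p F\<close> both corrections have nonpositive mean: by
  \<open>ES_eq\<close> the expected excess is \<open>(1 - p) * (ES p F - z)\<close>, at most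
  \<open>(1 - p) * (r - z)\<close>, and \<open>cdf F z\<close> is at least \<open>p\<close>.\<close>

lemma one_sided_upper_e:
  assumes p: "0 < p" "p < 1" and hk: "weights h k"
  shows "one_sided_e_statistic (ES p) (VaR p) below_diag (\<lambda>x r z. ennreal (upper_e p h k x r z))"
  unfolding one_sided_e_statistic_def
proof (intro conjI ballI allI impI)
  define M where "M = (restrict_space borel (UNIV \<times> below_diag) :: (real \<times> real \<times> real) measure)"
  have "snd \<in> M \<rightarrow>\<^sub>M restrict_space borel below_diag"
    unfolding M_def by (intro measurable_restrict_space3) (auto simp: borel_prod[symmetric])
  then have "(\<lambda>y. (\<lambda>(r, z). h r z) (snd y)) \<in> borel_measurable M"
    "(\<lambda>y. (\<lambda>(r, z). k r z) (snd y)) \<in> borel_measurable M"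
    using hk by (auto simp: weights_def intro: measurable_compose)
  then have [measurable]: "(\<lambda>y. h (fst (snd y)) (snd (snd y))) \<in> borel_measurable M"
    "(\<lambda>y. k (fst (snd y)) (snd (snd y))) \<in> borel_measurable M"
    by (simp_all add: split_beta')
  have "fst \<in> borel_measurable (borel :: (real \<times> real \<times> real) measure)"
    "(\<lambda>y. fst (snd y)) \<in> borel_measurable (borel :: (real \<times> real \<times> real) measure)"
    "(\<lambda>y. snd (snd y)) \<in> borel_measurable (borel :: (real \<times> real \<times> real) measure)"
    by (simp_all add: borel_prod[symmetric])
  then have [measurable]: "fst \<in> borel_measurable M" "(\<lambda>y. fst (snd y)) \<in> borel_measurable M"
    "(\<lambda>y. snd (snd y)) \<in> borel_measurable M"
    unfolding M_def by (auto intro: measurable_restrict_space1)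
  \<comment> \<open>Since \<open>z\<close> varies jointly with \<open>x\<close>, the indicator is
    treated as a conditional on the measurable predicate \<open>x \<le> z\<close>.\<close>
  have ind: "indicat_real {..z} x = (if x \<le> z then 1 else 0)" for x z :: real
    by simp
  have "(\<lambda>(x, r, z). ennreal (upper_e p h k x r z)) \<in> borel_measurable M"
    unfolding upper_e_def ind split_beta' by measurable
  then show "(\<lambda>(x, r, z). ennreal (upper_e p h k x r z))
      \<in> borel_measurable (restrict_space borel (UNIV \<times> below_diag))"
    by (simp only: M_def)
next
  fix F r
  assume F: "F \<in> M1" and r: "ES p F \<le> r" and "(r, VaR p F) \<in> below_diag"
  let ?z = "VaR p F"
  have z: "?z < r"
    using \<open>(r, VaR p F) \<in> below_diag\<close> by simp
  have w: "0 \<le> h r ?z" "0 \<le> k r ?z" "h r ?z + k r ?z \<le> 1"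
    using hk z by (auto simp: weights_def)
  have "(1 - p) * (ES p F - ?z) \<le> (1 - p) * (r - ?z)"
    using p r by simp
  then have "(\<integral>x. max (x - ?z) 0 \<partial>F) / ((1 - p) * (r - ?z)) - 1 \<le> 0"
    using ES_eq[OF F p] p z by simp
  moreover have "(p - cdf F ?z) / (1 - p) \<le> 0"
    using le_cdf_VaR[of F p] F p by (simp add: M1_def divide_nonpos_pos)
  ultimately have "h r ?z * ((\<integral>x. max (x - ?z) 0 \<partial>F) / ((1 - p) * (r - ?z)) - 1) \<le> 0"
    "k r ?z * ((p - cdf F ?z) / (1 - p)) \<le> 0"
    using w by (simp_all only: mult_nonneg_nonpos)
  then show "(\<integral>\<^sup>+x. ennreal (upper_e p h k x r ?z) \<partial>F) \<le> 1"
    unfolding nn_integral_upper_e[where h = h and k = k, OF p w z F] by (simp add: ennreal_le_1)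
qed

text \<open>
  Tested by the law with mass \<open>q = 1 - t * (1 - p) \<ge> p\<close> at \<open>z\<close> and the rest further up, placed so that
  the expected excess over \<open>z\<close> is \<open>c * (1 - p) * (r - z)\<close>.
\<close>

lemma backtest_upper_e_two_point:
  assumes p: "0 < p" "p < 1" and hk: "weights h k" and "z < r"
    and e: "backtest_e_statistic (ES p) (VaR p) below_diag (\<lambda>x r z. ennreal (upper_e p h k x r z))"
    and t: "0 < t" "t \<le> 1" and c: "1 < c"
  shows "0 < h r z * (c - 1) + k r z * (t - 1)"
proof -
  have w: "0 \<le> h r z" "0 \<le> k r z" "h r z + k r z \<le> 1"
    using hk \<open>z < r\<close> by (auto simp: weights_def)
  \<comment> \<open>This law attains the pair \<open>(r, z)\<close>, so the backtest condition
    applies there.\<close>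
  let ?G = "three_point p 1 z r r"
  have "ES p ?G = r" "VaR p ?G = z" "?G \<in> M1"
    using p \<open>z < r\<close> by (simp_all add: ES_three_point VaR_three_point three_point_M1)
  then have image: "(r, z) \<in> (\<lambda>F. (ES p F, VaR p F)) ` M1 \<inter> below_diag"
    using \<open>z < r\<close> by force
  define q where "q = 1 - t * (1 - p)"
  define y where "y = z + c / t * (r - z)"
  let ?F = "three_point q 1 z y y"
  have "0 \<le> t * (1 - p)" "t * (1 - p) \<le> 1 - p"
    using p t by (simp_all add: mult_left_le_one_le)
  then have "p \<le> q" "q \<le> 1"
    unfolding q_def by linarith+
  then have q: "p \<le> q" "q \<le> 1" "0 \<le> q"
    using p by simp_all
  have y: "z < y"
    using t c \<open>z < r\<close> by (simp add: y_def)
  have F: "?F \<in> M1"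
    using q by (simp add: three_point_M1)
  have ty: "(1 - q) * (y - z) = (1 - p) * (r - z) * c"
    using t by (simp add: q_def y_def)
  have "ES p ?F = z + (r - z) * c"
    using p q y by (simp add: ES_three_point ty)
  also have "\<dots> > r"
  proof -
    have "(r - z) * 1 < (r - z) * c"
      using c \<open>z < r\<close> by (intro mult_strict_left_mono) simp_all
    then show ?thesis
      by simp
  qed
  finally have "1 < (\<integral>\<^sup>+x. ennreal (upper_e p h k x r z) \<partial>?F)"
    using e image F unfolding backtest_e_statistic_def by blast
  moreover have "(\<integral>x. max (x - z) 0 \<partial>?F) / ((1 - p) * (r - z)) = c"
    using p q y \<open>z < r\<close> by (simp add: integral_three_point ty)
  moreover have "(p - cdf ?F z) / (1 - p) = t - 1"
    using p q y by (simp add: cdf_three_point) (simp add: q_def field_simps)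
  ultimately show ?thesis
    by (simp add: nn_integral_upper_e[where h = h and k = k, OF p w \<open>z < r\<close> F])
qed

text \<open>If \<open>k\<close> vanishes, \<open>ES_le\<close> at level \<open>z\<close>, whatever
  the quantile of \<open>F\<close>, makes the mean of the \<open>h\<close> term strictly positive.
  Conversely, two-point laws isolate \<open>h\<close> and rule out \<open>k\<close>.\<close>

lemma backtest_upper_e_iff:
  assumes p: "0 < p" "p < 1" and hk: "weights h k"
  shows "backtest_e_statistic (ES p) (VaR p) below_diag (\<lambda>x r z. ennreal (upper_e p h k x r z)) \<longleftrightarrow>
    (\<forall>r z. z < r \<longrightarrow> h r z > 0 \<and> k r z = 0)" (is "?B \<longleftrightarrow> ?P")
proof
  assume B: ?B
  show ?P
  proof (intro allI impI)
    fix r z :: real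
    assume z: "z < r"
    have w: "0 \<le> h r z" "0 \<le> k r z" "h r z + k r z \<le> 1"
      using hk z by (auto simp: weights_def)
    \<comment> \<open>\<open>t = 1\<close> removes the \<open>k\<close> term.\<close>
    have "0 < h r z"
      using backtest_upper_e_two_point[OF p hk z B, of 1 2] by simp
    moreover have "k r z = 0"
    proof (rule ccontr)
      assume "k r z \<noteq> 0"
      then have k: "0 < k r z"
        using w by simp
      have "h r z * k r z \<le> k r z"
        using w by (simp add: mult_left_le_one_le)
      \<comment> \<open>With \<open>t = 1/2\<close> the \<open>k\<close> term is
        \<open>- k r z / 2\<close>, while \<open>c - 1 = k r z / 4\<close> keeps the
        \<open>h\<close> term at most \<open>k r z / 4\<close>, so the sum is negative.\<close>
      then show False
        using backtest_upper_e_two_point[OF p hk z B, of "1/2" "1 + k r z / 4"] k by simp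
    qed
    ultimately show "0 < h r z \<and> k r z = 0"
      by simp
  qed
next
  assume P: ?P
  show ?B
    unfolding backtest_e_statistic_def
  proof (intro conjI one_sided_upper_e[OF p hk] ballI impI, clarify)
    fix r z and F
    assume z: "z < r" and F: "F \<in> M1" and r: "r < ES p F"
    have w: "0 \<le> h r z" "0 \<le> k r z" "h r z + k r z \<le> 1"
      using hk z by (auto simp: weights_def)
    have "(1 - p) * (r - z) < (1 - p) * (ES p F - z)"
      using p r by simp
    also have "\<dots> \<le> (\<integral>x. max (x - z) 0 \<partial>F)"
      by (rule ES_le[OF F p])
    finally have "0 < h r z * ((\<integral>x. max (x - z) 0 \<partial>F) / ((1 - p) * (r - z)) - 1)"
      using P p z by simp
    then show "1 < (\<integral>\<^sup>+x. ennreal (upper_e p h k x r z) \<partial>F)"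
      using P z by (simp add: nn_integral_upper_e[where h = h and k = k, OF p w z F])
  qed
qed

section \<open>Monotonicity in the forecast\<close>

text \<open>With \<open>k = 0\<close> the bound is \<open>1 - h r z\<close> up to \<open>z\<close>
  and then affine in \<open>x\<close> with slope \<open>h r z / ((1 - p) * (r - z))\<close>.
  Arguments up to \<open>z\<close> detect the monotonicity of \<open>h\<close>, large ones that of
  the slope.\<close>

lemma antimono_upper_e_iff:
  assumes p: "0 < p" "p < 1"
    and h: "\<And>r. z < r \<Longrightarrow> 0 < h r z" "\<And>r. z < r \<Longrightarrow> h r z \<le> 1" and k: "\<And>r. z < r \<Longrightarrow> k r z = 0"
  shows "(\<forall>x. antimono_on {z<..} (\<lambda>r. ennreal (upper_e p h k x r z))) \<longleftrightarrow>
    mono_on {z<..} (\<lambda>r. h r z) \<and> mono_on {z<..} (\<lambda>r. (r - z) / h r z)"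
proof -
  have eq1: "upper_e p h k x r z = 1 - h r z" if "x \<le> z" "z < r" for x r
    using that by (simp add: upper_e_def k)
  have eq2: "upper_e p h k x r z = 1 - h r z + (x - z) / (1 - p) * (h r z / (r - z))"
    if "z \<le> x" "z < r" for x r
    using that by (simp add: upper_e_def k algebra_simps)
  have nonneg: "0 \<le> upper_e p h k x r z" if "z < r" for x r
    using h[OF that] k[OF that] that by (intro upper_e_nonneg[OF p]) auto
  have inv: "(r - z) / h r z \<le> (r' - z) / h r' z \<longleftrightarrow> h r' z / (r' - z) \<le> h r z / (r - z)"
    if "z < r" "z < r'" for r r'
    using that h(1)[of r] h(1)[of r'] by (simp add: divide_simps mult.commute)
  show ?thesis
  proof (intro iffI conjI mono_onI allI)
    fix r r'
    assume A: "\<forall>x. antimono_on {z<..} (\<lambda>r. ennreal (upper_e p h k x r z))"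
      and r: "r \<in> {z<..}" "r' \<in> {z<..}" "r \<le> r'"
    then have z: "z < r" "z < r'"
      by auto
    have le: "upper_e p h k x r' z \<le> upper_e p h k x r z" for x
      using monotone_onD[OF A[rule_format] r] nonneg[OF z(1)] by simp
    show "h r z \<le> h r' z"
      using le[of z] z by (simp add: eq1)
    show "(r - z) / h r z \<le> (r' - z) / h r' z"
      unfolding inv[OF z]
    proof (rule ccontr)
      assume "\<not> h r' z / (r' - z) \<le> h r z / (r - z)"
      then have d: "0 < h r' z / (r' - z) - h r z / (r - z)" (is "0 < ?d")
        by simp
      \<comment> \<open>Here the gap \<open>?d\<close> contributes exactly 1, whereas
        \<open>h r' z - h r z < 1\<close> because \<open>h\<close> takes values in (0, 1].\<close>
      define x where "x = z + (1 - p) * (1 / ?d)"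
      have x: "z \<le> x" "(x - z) / (1 - p) = 1 / ?d"
        using p d by (simp_all add: x_def)
      have "1 / ?d * ?d \<le> h r' z - h r z"
        using le[of x]
        by (simp add: eq2[OF x(1) z(1)] eq2[OF x(1) z(2)] x(2) right_diff_distrib
            del: times_divide_eq_left)
      then show False
        using d h(2)[OF z(2)] h(1)[OF z(1)] by simp
    qed
  next
    fix x
    assume "mono_on {z<..} (\<lambda>r. h r z) \<and> mono_on {z<..} (\<lambda>r. (r - z) / h r z)"
    then have M: "mono_on {z<..} (\<lambda>r. h r z)" "mono_on {z<..} (\<lambda>r. (r - z) / h r z)"
      by auto
    show "antimono_on {z<..} (\<lambda>r. ennreal (upper_e p h k x r z))"
    proof (rule monotone_onI)
      fix r r'
      assume r: "r \<in> {z<..}" "r' \<in> {z<..}" "r \<le> r'"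
      then have z: "z < r" "z < r'"
        by auto
      have h: "h r z \<le> h r' z"
        using mono_onD[OF M(1) r] .
      have g: "h r' z / (r' - z) \<le> h r z / (r - z)"
        using mono_onD[OF M(2) r] inv[OF z] by simp
      have "upper_e p h k x r' z \<le> upper_e p h k x r z"
      proof (cases "x \<le> z")
        case True
        then show ?thesis
          using h z by (simp add: eq1)
      next
        case False
        then show ?thesis
          using h z p mult_left_mono[OF g, of "(x - z) / (1 - p)"] by (simp add: eq2)
      qed
      then show "ennreal (upper_e p h k x r' z) \<le> ennreal (upper_e p h k x r z)"
        by (rule ennreal_leI)
    qed
  qed
qed

text \<open>Positivity of \<open>h\<close> stands beside the monotonicity conditions because
  division by zero gives 0: for \<open>h\<close> identically 0 both functions would be increasing,
  yet there is no backtest.\<close>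

lemma monotone_backtest_upper_e_iff:
  assumes p: "0 < p" "p < 1" and hk: "weights h k"
  shows "monotone_backtest_e_statistic (ES p) (VaR p) below_diag (\<lambda>x r z. ennreal (upper_e p h k x r z)) \<longleftrightarrow>
    (\<forall>r z. z < r \<longrightarrow> h r z > 0 \<and> k r z = 0) \<and>
    (\<forall>z. mono_on {z<..} (\<lambda>r. h r z) \<and> mono_on {z<..} (\<lambda>r. (r - z) / h r z))"
proof -
  have D: "{r. (r, z) \<in> below_diag} = {z<..}" for z :: real
    by auto
  have "(\<forall>x. antimono_on {z<..} (\<lambda>r. ennreal (upper_e p h k x r z))) \<longleftrightarrow>
      mono_on {z<..} (\<lambda>r. h r z) \<and> mono_on {z<..} (\<lambda>r. (r - z) / h r z)"
    if "\<forall>r z. z < r \<longrightarrow> h r z > 0 \<and> k r z = 0" for z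
    using that hk by (intro antimono_upper_e_iff[OF p]) (auto simp: weights_def)
  then show ?thesis
    unfolding monotone_backtest_e_statistic_def backtest_upper_e_iff[OF p hk] D by blast
qed

theorem theorem5:
  fixes p :: real
  assumes "0 < p" and "p < 1"
  shows
    "(\<forall>e :: real \<Rightarrow> real \<Rightarrow> real \<Rightarrow> ennreal.
        one_sided_e_statistic (ES p) (VaR p) UNIV e \<and> (\<forall>r z. mono (\<lambda>x. e x r z)) \<longrightarrow>
        (\<exists>h k. weights h k \<and> (\<forall>x r z. z < r \<longrightarrow> e x r z \<le> ennreal (upper_e p h k x r z)))) \<and>
     (\<forall>h k. weights h k \<longrightarrow>
        (\<forall>x r z. z < r \<longrightarrow> 0 \<le> upper_e p h k x r z) \<and>
        one_sided_e_statistic (ES p) (VaR p) below_diag (\<lambda>x r z. ennreal (upper_e p h k x r z)) \<and>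
        (backtest_e_statistic (ES p) (VaR p) below_diag (\<lambda>x r z. ennreal (upper_e p h k x r z)) \<longleftrightarrow>
           (\<forall>r z. z < r \<longrightarrow> h r z > 0 \<and> k r z = 0)) \<and>
        ((\<forall>r z. z < r \<longrightarrow> h r z > 0 \<and> k r z = 0) \<and>
         (\<forall>z. mono_on {z<..} (\<lambda>r. h r z) \<and> mono_on {z<..} (\<lambda>r. (r - z) / h r z)) \<longleftrightarrow>
           monotone_backtest_e_statistic (ES p) (VaR p) below_diag
             (\<lambda>x r z. ennreal (upper_e p h k x r z))))"
proof (intro conjI allI impI)
  fix e :: "real \<Rightarrow> real \<Rightarrow> real \<Rightarrow> ennreal"
  assume "one_sided_e_statistic (ES p) (VaR p) UNIV e \<and> (\<forall>r z. mono (\<lambda>x. e x r z))"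
  then show "\<exists>h k. weights h k \<and> (\<forall>x r z. z < r \<longrightarrow> e x r z \<le> ennreal (upper_e p h k x r z))"
    using one_sided_upper_bound[OF assms, of e] by metis
next
  fix h k x r z
  assume "weights h k" "z < (r :: real)"
  then show "0 \<le> upper_e p h k x r z"
    by (intro upper_e_nonneg assms) (auto simp: weights_def)
next
  fix h k
  assume hk: "weights h k"
  show "one_sided_e_statistic (ES p) (VaR p) below_diag (\<lambda>x r z. ennreal (upper_e p h k x r z))"
    by (rule one_sided_upper_e[OF assms hk])
  show "backtest_e_statistic (ES p) (VaR p) below_diag (\<lambda>x r z. ennreal (upper_e p h k x r z)) \<longleftrightarrow>
      (\<forall>r z. z < r \<longrightarrow> h r z > 0 \<and> k r z = 0)"
    by (rule backtest_upper_e_iff[OF assms hk])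
  show "(\<forall>r z. z < r \<longrightarrow> h r z > 0 \<and> k r z = 0) \<and>
      (\<forall>z. mono_on {z<..} (\<lambda>r. h r z) \<and> mono_on {z<..} (\<lambda>r. (r - z) / h r z)) \<longleftrightarrow>
      monotone_backtest_e_statistic (ES p) (VaR p) below_diag (\<lambda>x r z. ennreal (upper_e p h k x r z))"
    by (rule monotone_backtest_upper_e_iff[OF assms hk, symmetric])
qed

end
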